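(* For $p>2$ let $\psi_p:\mathbb{R}\to\mathbb{R}$ be given by $\psi_p(x)=\frac{|x|^{p+1}}{p+1}$ for $|x|\le 1$ and $\psi_p(x)=\frac1{p+1}+(|x|-1)+\frac p2(|x|-1)^2$ for $|x|\ge 1$, and consider the family, indexed by $p>2$, of bi-objective problems $\min_{x\in\mathbb{R}}(f_1(x),f_2(x))$ with $f_1(x)=\psi_p(x)$ and $f_2(x)=2x+\psi_p(x)$. Put $H_p:=p(p-1)$. Suppose $p>2$, let $x^0\in(0,1)$, and let $\{x^k\}$ be generated from $x^0$ by the regularized Newton iteration described in the context with the square-root rule $\eta_k=2\sqrt{H_p\,s(x^k)}$. Then there exist constants $c_2>c_1>0$ and an integer $K\ge 1$ such that, for all $k\ge K$, $$c_1k^{-q_p}\le \mathcal{U}(x^k)\le c_2k^{-q_p},\qquad q_p:=\frac{2(p+1)}{p-2}=2+\frac{6}{p-2}.$$ Consequently, for every $\delta>0$, no uniform estimate of the form $\mathcal{U}(x^k)=\mathcal{O}(k^{-(2+\delta)})$ can hold over this family.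
   Context: Merit function: $\mathcal{U}(x):=\sup_{z\in\mathbb{R}}\min_{i\in\{1,2\}}\{f_i(x)-f_i(z)\}$. Stationarity measure: $s(x):=\min_{\lambda\in[0,1]}|\lambda f_1'(x)+(1-\lambda)f_2'(x)|$. Quadratic models: $q_i(d;x):=f_i'(x)d+\frac12 f_i''(x)d^2$, $i=1,2$. Iteration: starting from $x^0$, for $k=0,1,2,\dots$: if $s(x^k)=0$ stop; otherwise let $d^k$ be the unique minimizer over $d\in\mathbb{R}$ of $\max\{q_1(d;x^k),q_2(d;x^k)\}+\frac{\eta_k}{2}d^2$ and set $x^{k+1}:=x^k+d^k$. (The number $H_p=p(p-1)$ is a Lipschitz constant of $\psi_p''$, hence of $f_1''$ and $f_2''$.) *)

theory Defs
  imports "HOL-Analysis.Analysis" "HOL-Library.Landau_Symbols"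
begin

(* The real supremum in merit is only meaningful if the set is bounded above,
   which holds as soon as one of the objectives is bounded below. *)
definition merit :: "(real \<Rightarrow> real) \<Rightarrow> (real \<Rightarrow> real) \<Rightarrow> real \<Rightarrow> real" where
  "merit f1 f2 x = (SUP z. min (f1 x - f1 z) (f2 x - f2 z))"

(* The infimum is attained: a continuous function on a nonempty compact interval. *)
definition stationarity :: "(real \<Rightarrow> real) \<Rightarrow> (real \<Rightarrow> real) \<Rightarrow> real \<Rightarrow> real" where
  "stationarity f1 f2 x = (INF l\<in>{0..1}. \<bar>l * deriv f1 x + (1 - l) * deriv f2 x\<bar>)"

definition quad_model :: "(real \<Rightarrow> real) \<Rightarrow> real \<Rightarrow> real \<Rightarrow> real" where
  "quad_model f x d = deriv f x * d + 1/2 * deriv (deriv f) x * d\<^sup>2"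

definition newton_step :: "(real \<Rightarrow> real) \<Rightarrow> (real \<Rightarrow> real) \<Rightarrow> real \<Rightarrow> real \<Rightarrow> real" where
  "newton_step f1 f2 \<eta> x =
     (THE d. is_arg_min (\<lambda>d. max (quad_model f1 x d) (quad_model f2 x d) + \<eta>/2 * d\<^sup>2) (\<lambda>_. True) d)"

(* The regularization parameter is a function eta of the current iterate.
   Stopping at a stationary iterate is modelled by repeating that iterate forever. *)
primrec newton_iter ::
  "(real \<Rightarrow> real) \<Rightarrow> (real \<Rightarrow> real) \<Rightarrow> (real \<Rightarrow> real) \<Rightarrow> real \<Rightarrow> nat \<Rightarrow> real" where
  "newton_iter f1 f2 eta x0 0 = x0"
| "newton_iter f1 f2 eta x0 (Suc k) =
     (let x = newton_iter f1 f2 eta x0 k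
      in if stationarity f1 f2 x = 0 then x else x + newton_step f1 f2 (eta x) x)"

definition psi :: "real \<Rightarrow> real \<Rightarrow> real" where
  "psi p x = (if \<bar>x\<bar> \<le> 1 then \<bar>x\<bar> powr (p + 1) / (p + 1)
              else 1 / (p + 1) + (\<bar>x\<bar> - 1) + p/2 * (\<bar>x\<bar> - 1)\<^sup>2)"

definition obj1 :: "real \<Rightarrow> real \<Rightarrow> real" where
  "obj1 p x = psi p x"

definition obj2 :: "real \<Rightarrow> real \<Rightarrow> real" where
  "obj2 p x = 2 * x + psi p x"

definition hess_lip :: "real \<Rightarrow> real" where
  "hess_lip p = p * (p - 1)"

definition sqrt_rule :: "real \<Rightarrow> real \<Rightarrow> real" where
  "sqrt_rule p x = 2 * sqrt (hess_lip p * stationarity (obj1 p) (obj2 p) x)"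

definition iterate :: "real \<Rightarrow> real \<Rightarrow> nat \<Rightarrow> real" where
  "iterate p x0 = newton_iter (obj1 p) (obj2 p) (sqrt_rule p) x0"

definition rate_exp :: "real \<Rightarrow> real" where
  "rate_exp p = 2 * (p + 1) / (p - 2)"

end

theory Submission imports Defs begin

text \<open>On \<open>(0,1)\<close> the stationarity measure is \<open>x powr p\<close> and the merit function is
  \<open>x powr (p + 1) / (p + 1)\<close>, so only the speed of \<open>x\<^sup>k \<longlonglongrightarrow> 0\<close> matters. With
  \<open>r = (p - 2) / 2\<close> the step reads
  \<open>x - x powr (r + 1) / (p * x powr r + B)\<close>, \<open>B = 2 * sqrt (hess_lip p)\<close>. Hence \<open>v = x powr (- r)\<close>
  grows by an amount bounded between two positive constants at each iteration, so \<open>v\<close> is of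
  exact order \<open>k\<close>, and the merit is \<open>v powr (- rate_exp p) / (p + 1)\<close>.\<close>

section \<open>Closed forms of merit, derivatives and stationarity on \<open>(0,1)\<close>\<close>

lemma psi_nonneg:
  assumes "p > 0" shows "psi p x \<ge> 0"
  using assms by (auto simp: psi_def)

text \<open>The supremum is attained at \<open>z = 0\<close>: the gap of \<open>obj1\<close> is the
  smaller one there because \<open>x > 0\<close>, and for any \<open>z\<close> that gap is at most
  \<open>psi p x\<close> because \<open>psi\<close> is nonnegative.\<close>

lemma merit_obj:
  assumes "p > 0" "0 < x" "x < 1"
  shows "merit (obj1 p) (obj2 p) x = x powr (p + 1) / (p + 1)"
  unfolding merit_def
proof (rule cSup_eq_maximum)
  have at_0: "min (obj1 p x - obj1 p 0) (obj2 p x - obj2 p 0) = x powr (p + 1) / (p + 1)"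
    using assms by (simp add: obj1_def obj2_def psi_def)
  show "x powr (p + 1) / (p + 1) \<in> range (\<lambda>z. min (obj1 p x - obj1 p z) (obj2 p x - obj2 p z))"
    by (rule range_eqI[where x = 0]) (rule at_0[symmetric])
next
  fix y assume "y \<in> range (\<lambda>z. min (obj1 p x - obj1 p z) (obj2 p x - obj2 p z))"
  then obtain z where "y = min (obj1 p x - obj1 p z) (obj2 p x - obj2 p z)" by blast
  then have "y \<le> psi p x - psi p z" by (simp add: obj1_def)
  also have "\<dots> \<le> psi p x" using assms psi_nonneg by simp
  finally show "y \<le> x powr (p + 1) / (p + 1)"
    using assms by (simp add: psi_def)
qed

lemma has_real_derivative_psi:
  assumes "p > 0" "0 < x" "x < 1"
  shows "(psi p has_real_derivative x powr p) (at x)"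
proof (rule has_field_derivative_transform_within_open[where S = "{0<..<1}"])
  show "((\<lambda>x. x powr (p + 1) / (p + 1)) has_real_derivative x powr p) (at x)"
    using assms by (auto intro!: derivative_eq_intros)
qed (use assms in \<open>auto simp: psi_def\<close>)

lemma deriv_obj:
  assumes "p > 0" "0 < x" "x < 1"
  shows "deriv (obj1 p) x = x powr p" "deriv (obj2 p) x = 2 + x powr p"
  unfolding obj1_def obj2_def
  by (rule DERIV_imp_deriv; use assms in \<open>auto intro!: derivative_eq_intros has_real_derivative_psi\<close>)+

lemma deriv_deriv_obj:
  assumes "p > 0" "0 < x" "x < 1"
  shows "deriv (deriv (obj1 p)) x = p * x powr (p - 1)"
    and "deriv (deriv (obj2 p)) x = p * x powr (p - 1)"
proof -
  have "(deriv (obj1 p) has_real_derivative p * x powr (p - 1)) (at x)"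
    by (rule has_field_derivative_transform_within_open[where S = "{0<..<1}" and f = "\<lambda>x. x powr p"])
      (use assms in \<open>auto simp: deriv_obj intro!: derivative_eq_intros\<close>)
  then show "deriv (deriv (obj1 p)) x = p * x powr (p - 1)" by (rule DERIV_imp_deriv)
  have "(deriv (obj2 p) has_real_derivative p * x powr (p - 1)) (at x)"
    by (rule has_field_derivative_transform_within_open
        [where S = "{0<..<1}" and f = "\<lambda>x. 2 + x powr p"])
      (use assms in \<open>auto simp: deriv_obj intro!: derivative_eq_intros\<close>)
  then show "deriv (deriv (obj2 p)) x = p * x powr (p - 1)" by (rule DERIV_imp_deriv)
qed

text \<open>The derivatives are positive and differ by the constant 2, so the weight
  \<open>l = 1\<close> is optimal.\<close>

lemma stationarity_obj:
  assumes "p > 0" "0 < x" "x < 1"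
  shows "stationarity (obj1 p) (obj2 p) x = x powr p"
  unfolding stationarity_def
proof (rule cInf_eq_minimum)
  show "x powr p \<in> (\<lambda>l. \<bar>l * deriv (obj1 p) x + (1 - l) * deriv (obj2 p) x\<bar>) ` {0..1}"
    by (rule image_eqI[where x = 1]) (use assms in \<open>auto simp: deriv_obj\<close>)
next
  fix y assume "y \<in> (\<lambda>l. \<bar>l * deriv (obj1 p) x + (1 - l) * deriv (obj2 p) x\<bar>) ` {0..1}"
  then obtain l where "l \<le> 1" "y = \<bar>l * deriv (obj1 p) x + (1 - l) * deriv (obj2 p) x\<bar>" by auto
  moreover have "l * deriv (obj1 p) x + (1 - l) * deriv (obj2 p) x = x powr p + 2 * (1 - l)"
    using assms by (simp add: deriv_obj algebra_simps)
  ultimately show "x powr p \<le> y" by simp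
qed

section \<open>The regularized Newton step in closed form\<close>

text \<open>The two models differ by \<open>2 * d\<close>, so the maximum only adds
  \<open>max 0 (2 * d)\<close> to the first one. This term is nonnegative and vanishes for
  \<open>d \<le> 0\<close>, where the minimizer of the regularized first model lies.\<close>

lemma newton_step_obj:
  assumes "p > 0" "0 < x" "x < 1" "\<eta> \<ge> 0"
  shows "newton_step (obj1 p) (obj2 p) \<eta> x = - (x powr p / (p * x powr (p - 1) + \<eta>))"
proof -
  define A where "A = p * x powr (p - 1) + \<eta>"
  define g where "g = x powr p"
  have A: "A > 0" and g: "g > 0" using assms by (auto simp: A_def g_def intro!: add_pos_nonneg)
  define F where "F = (\<lambda>d. max (quad_model (obj1 p) x d) (quad_model (obj2 p) x d) + \<eta>/2 * d\<^sup>2)"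
  have F: "F d = g * d + A/2 * d\<^sup>2 + max 0 (2 * d)" for d
    using assms
    by (auto simp: F_def A_def g_def quad_model_def deriv_obj deriv_deriv_obj algebra_simps max_def)
  have square: "g * d + A/2 * d\<^sup>2 = A/2 * (d + g/A)\<^sup>2 - g\<^sup>2 / (2*A)" for d
    using A by (simp add: field_simps power2_eq_square)
  have Fmin: "F (- (g/A)) = - (g\<^sup>2 / (2*A))"
  proof -
    have "max 0 (2 * - (g/A)) = 0" using A g by (intro max_absorb1) simp
    then show ?thesis unfolding F square using A by simp
  qed
  \<comment> \<open>Quadratic growth around the candidate yields minimality and the uniqueness that
    \<open>THE\<close> requires.\<close>
  have F_ge: "F d \<ge> A/2 * (d + g/A)\<^sup>2 + F (- (g/A))" for d
    unfolding Fmin unfolding F square by simp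
  have "is_arg_min F (\<lambda>_. True) d \<longleftrightarrow> d = - (g/A)" for d
  proof
    assume "is_arg_min F (\<lambda>_. True) d"
    then have "\<not> F (- (g/A)) < F d" by (simp add: is_arg_min_def)
    with F_ge[of d] have "A/2 * (d + g/A)\<^sup>2 \<le> 0" by linarith
    then have "(d + g/A)\<^sup>2 \<le> 0" using A by (simp add: mult_le_0_iff)
    then show "d = - (g/A)" by simp
  next
    assume d: "d = - (g/A)"
    have "F d \<le> F d'" for d'
    proof -
      have "0 \<le> A/2 * (d' + g/A)\<^sup>2" using A by simp
      with F_ge[of d'] show ?thesis unfolding d by linarith
    qed
    then show "is_arg_min F (\<lambda>_. True) d" by (simp add: is_arg_min_def not_less)
  qed
  then have "(THE d. is_arg_min F (\<lambda>_. True) d) = - (g/A)" by simp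
  then show ?thesis
    unfolding newton_step_def F_def[symmetric] by (simp add: A_def g_def)
qed

lemma newton_step_sqrt_rule:
  fixes p x :: real
  defines "u \<equiv> x powr ((p - 2) / 2)"
  assumes "p > 2" "0 < x" "x < 1"
  shows "x + newton_step (obj1 p) (obj2 p) (sqrt_rule p x) x
       = x * (1 - u / (p * u + 2 * sqrt (hess_lip p)))"
proof -
  define w where "w = x powr (p / 2)"
  have w: "w > 0" "w = x * u"
    using assms powr_add[of x 1 "(p - 2) / 2"] by (auto simp: w_def u_def field_simps)
  \<comment> \<open>The regularization is \<open>2 * sqrt (hess_lip p) * w\<close>, so one factor
    \<open>w\<close> cancels from the quotient and the other equals \<open>x * u\<close>.\<close>
  have "x powr p = w * w" and "x powr (p - 1) = w * u"
    by (simp_all add: w_def u_def powr_add[symmetric] diff_divide_distrib)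
  then have "x powr p / (p * x powr (p - 1) + sqrt_rule p x)
       = (w * w) / (w * (p * u + 2 * sqrt (hess_lip p)))"
    using assms(2-) w(1) by (simp add: sqrt_rule_def stationarity_obj real_sqrt_mult algebra_simps)
  also have "\<dots> = x * (u / (p * u + 2 * sqrt (hess_lip p)))"
    using w by simp
  finally show ?thesis
    using assms by (simp add: newton_step_obj sqrt_rule_def hess_lip_def stationarity_obj algebra_simps)
qed

section \<open>Linear growth of a negative power of the iterates\<close>

text \<open>When \<open>x\<close> shrinks by the factor \<open>1 - t\<close>, its power
  \<open>x powr (- r)\<close> grows by \<open>(1 - t) powr (- r)\<close>. The excess of this factor
  over 1 is of order \<open>t\<close>, with constants depending only on \<open>r\<close>.\<close>

lemma powr_neg_one_minus_bounds:
  fixes r t :: real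
  assumes "r > 0" "0 \<le> t" "t \<le> 1/2"
  shows "r * t \<le> (1 - t) powr (- r) - 1"
    and "(1 - t) powr (- r) - 1 \<le> 2 * r * exp r * t"
proof -
  have exp: "(1 - t) powr (- r) = exp (r * - ln (1 - t))"
    using assms by (simp add: powr_def)
  have "ln (1 - t) \<le> - t" using ln_le_minus_one[of "1 - t"] assms by simp
  then have "r * t \<le> r * - ln (1 - t)" using assms by (intro mult_left_mono) auto
  then show "r * t \<le> (1 - t) powr (- r) - 1"
    unfolding exp using exp_ge_add_one_self[of "r * - ln (1 - t)"] by linarith
  have "- ln (1 - t) = ln (1 / (1 - t))" using assms by (simp add: ln_div)
  also have "\<dots> \<le> 1 / (1 - t) - 1" using assms by (intro ln_le_minus_one) auto
  also have "\<dots> \<le> 2 * t"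
  proof -
    have "t * t \<le> t * (1/2)" using assms by (intro mult_left_mono) auto
    then show ?thesis using assms by (simp add: field_simps)
  qed
  finally have "r * - ln (1 - t) \<le> r * (2 * t)" using assms by (intro mult_left_mono) auto
  then have le: "exp (r * - ln (1 - t)) \<le> exp (2 * r * t)" by (simp add: mult_ac)
  \<comment> \<open>With \<open>y = 2 * r * t\<close>, multiplying by \<open>exp y\<close> gives
    \<open>exp y - 1 \<le> y * exp y\<close>, and \<open>t \<le> 1/2\<close> bounds
    \<open>exp y\<close> by \<open>exp r\<close>.\<close>
  have "1 - 2 * r * t \<le> exp (- (2 * r * t))" using exp_ge_add_one_self[of "- (2 * r * t)"] by simp
  then have "(1 - 2 * r * t) * exp (2 * r * t) \<le> exp (- (2 * r * t)) * exp (2 * r * t)"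
    by (intro mult_right_mono) auto
  then have "exp (2 * r * t) - 1 \<le> 2 * r * t * exp (2 * r * t)"
    by (simp add: exp_minus field_simps)
  also have "\<dots> \<le> 2 * r * t * exp r"
    using assms by (intro mult_left_mono) (auto simp: field_simps)
  finally show "(1 - t) powr (- r) - 1 \<le> 2 * r * exp r * t"
    unfolding exp using le by (simp only: mult_ac)
qed

lemma iterate_Suc:
  fixes p x0 :: real and k :: nat
  defines "x \<equiv> iterate p x0 k"
  assumes "p > 2" "0 < x" "x < 1"
  shows "iterate p x0 (Suc k)
       = x * (1 - x powr ((p - 2) / 2) / (p * x powr ((p - 2) / 2) + 2 * sqrt (hess_lip p)))"
  using assms newton_step_sqrt_rule[of p x]
  by (simp add: iterate_def Let_def stationarity_obj)

text \<open>Here \<open>u / (p * u + B)\<close> is the relative step: it is comparable to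
  \<open>u\<close>, and \<open>p > 2\<close> alone keeps it below one half, as the bounds on
  \<open>(1 - t) powr (- r)\<close> demand.\<close>

lemma relative_step_bounds:
  fixes p u B :: real
  assumes "p > 2" "0 < u" "u \<le> 1" "B > 0"
  shows "u / (p + B) \<le> u / (p * u + B)" "u / (p * u + B) \<le> u / B" "u / (p * u + B) \<le> 1/2"
proof -
  have pu: "p * u > 0" "p * u + B > 0" "p * u \<le> p" "2 * u \<le> p * u"
    using assms by (auto intro!: add_pos_pos)
  show "u / (p + B) \<le> u / (p * u + B)" "u / (p * u + B) \<le> u / B"
    using assms pu by (auto intro!: divide_left_mono mult_pos_pos add_pos_pos)
  have "2 * u \<le> p * u + B" using assms(4) pu(4) by linarith
  then have "u / (p * u + B) \<le> u / (2 * u)"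
    using assms pu(2) by (intro divide_left_mono) auto
  also have "\<dots> = 1/2" using assms by simp
  finally show "u / (p * u + B) \<le> 1/2" .
qed

text \<open>Each step multiplies by \<open>1 - t\<close> with \<open>0 < t \<le> 1/2\<close>, so the
  closed forms apply at every iterate.\<close>

lemma iterate_in_unit_interval:
  assumes "p > 2" "0 < x0" "x0 < 1"
  shows "0 < iterate p x0 k \<and> iterate p x0 k < 1"
proof (induction k)
  case 0
  then show ?case using assms by (simp add: iterate_def)
next
  case (Suc k)
  define x where "x = iterate p x0 k"
  define t where "t = x powr ((p - 2) / 2) / (p * x powr ((p - 2) / 2) + 2 * sqrt (hess_lip p))"
  have x: "0 < x" "x < 1" using Suc by (auto simp: x_def)
  have "x powr ((p - 2) / 2) \<le> 1" using x assms by (auto simp: powr_le1)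
  then have "t \<le> 1/2" unfolding t_def
    using x assms by (intro relative_step_bounds(3)) (auto simp: hess_lip_def)
  moreover have "t > 0" unfolding t_def
    using x assms by (auto simp: hess_lip_def intro!: divide_pos_pos add_pos_nonneg)
  moreover have "iterate p x0 (Suc k) = x * (1 - t)"
    using iterate_Suc[of p x0 k] x assms by (simp add: x_def t_def)
  ultimately show ?case
    using x mult_strict_mono[of x 1 "1 - t" 1] by simp
qed

lemma iterate_powr_increment:
  fixes p x0 :: real
  defines "r \<equiv> (p - 2) / 2" and "B \<equiv> 2 * sqrt (hess_lip p)"
  assumes "p > 2" "0 < x0" "x0 < 1"
  shows "r / (p + B) \<le> iterate p x0 (Suc k) powr (- r) - iterate p x0 k powr (- r)"
    and "iterate p x0 (Suc k) powr (- r) - iterate p x0 k powr (- r) \<le> 2 * r * exp r / B"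
proof -
  define x where "x = iterate p x0 k"
  define u where "u = x powr r"
  define t where "t = u / (p * u + B)"
  have x: "0 < x" "x < 1" using iterate_in_unit_interval assms by (auto simp: x_def)
  have r: "r > 0" and B: "B > 0" using assms by (auto simp: r_def B_def hess_lip_def)
  have u: "0 < u" "u \<le> 1" using x r by (auto simp: u_def powr_le1)
  note t_bounds = relative_step_bounds[OF \<open>p > 2\<close> u B, folded t_def]
  have t: "0 \<le> t" using u B assms by (simp add: t_def)
  have "iterate p x0 (Suc k) = x * (1 - t)"
    using iterate_Suc[of p x0 k] x assms by (simp add: x_def t_def u_def r_def B_def)
  then have "iterate p x0 (Suc k) powr (- r) = x powr (- r) * (1 - t) powr (- r)"
    using x t_bounds(3) by (simp add: powr_mult)
  \<comment> \<open>This factor \<open>1 / u\<close> cancels the \<open>u\<close> in both bounds on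
    \<open>t\<close>, which makes the increment bounds independent of \<open>k\<close>.\<close>
  moreover have "x powr (- r) = 1 / u" by (simp add: u_def powr_minus divide_inverse)
  ultimately have eq: "iterate p x0 (Suc k) powr (- r) - iterate p x0 k powr (- r)
      = ((1 - t) powr (- r) - 1) / u"
    by (simp add: x_def diff_divide_distrib)
  note bounds = powr_neg_one_minus_bounds[OF r t t_bounds(3)]
  have "r / (p + B) = r * (u / (p + B)) / u" using u by simp
  also have "\<dots> \<le> ((1 - t) powr (- r) - 1) / u"
    using u r t_bounds(1) by (intro divide_right_mono order.trans[OF _ bounds(1)] mult_left_mono) auto
  finally show "r / (p + B) \<le> iterate p x0 (Suc k) powr (- r) - iterate p x0 k powr (- r)"
    unfolding eq .
  have "((1 - t) powr (- r) - 1) / u \<le> 2 * r * exp r * (u / B) / u"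
    using u r t_bounds(2) by (intro divide_right_mono order.trans[OF bounds(2)] mult_left_mono) auto
  also have "\<dots> = 2 * r * exp r / B" using u by simp
  finally show "iterate p x0 (Suc k) powr (- r) - iterate p x0 k powr (- r) \<le> 2 * r * exp r / B"
    unfolding eq .
qed

lemma linear_growth_bounds:
  fixes v :: "nat \<Rightarrow> real"
  assumes "\<And>k. a \<le> v (Suc k) - v k" "\<And>k. v (Suc k) - v k \<le> b"
  shows "v 0 + a * real k \<le> v k \<and> v k \<le> v 0 + b * real k"
proof (induction k)
  case (Suc k)
  then show ?case using assms(1)[of k] assms(2)[of k] by (simp add: algebra_simps)
qed simp

section \<open>The two-sided rate and its sharpness\<close>

lemma merit_iterate_bounds:
  assumes p: "p > 2" and x0: "0 < x0" "x0 < 1"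
  shows "\<exists>c1 c2. 0 < c1 \<and> c1 < c2 \<and>
           (\<forall>k\<ge>1. c1 * real k powr (- rate_exp p) \<le> merit (obj1 p) (obj2 p) (iterate p x0 k) \<and>
                   merit (obj1 p) (obj2 p) (iterate p x0 k) \<le> c2 * real k powr (- rate_exp p))"
proof -
  define r where "r = (p - 2) / 2"
  define q where "q = rate_exp p"
  define B where "B = 2 * sqrt (hess_lip p)"
  define a where "a = r / (p + B)"
  define b where "b = 2 * r * exp r / B"
  define v where "v = (\<lambda>k. iterate p x0 k powr (- r))"
  have r: "r > 0" and B: "B > 0" using p by (auto simp: r_def B_def hess_lip_def)
  have a: "a > 0" using r B p by (auto simp: a_def)
  have b: "b > 0" using r B by (simp add: b_def)
  have q: "q > 0" using p by (simp add: q_def rate_exp_def)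
  have rq: "r * q = p + 1" using p by (simp add: r_def q_def rate_exp_def field_simps)
  note x = iterate_in_unit_interval[OF p x0]
  have v_pos: "v k > 0" for k using x[of k] by (simp add: v_def)
  have growth: "v 0 + a * real k \<le> v k \<and> v k \<le> v 0 + b * real k" for k
    by (rule linear_growth_bounds)
      (use iterate_powr_increment[OF p x0] in \<open>auto simp: v_def a_def b_def r_def B_def\<close>)
  have merit: "merit (obj1 p) (obj2 p) (iterate p x0 k) = v k powr (- q) / (p + 1)" for k
    using x[of k] p by (simp add: merit_obj v_def powr_powr rq add.commute)
  \<comment> \<open>For \<open>k \<ge> 1\<close> the growth bounds give
    \<open>a * k \<le> v k \<le> (v 0 + b) * k\<close>; the exponent \<open>- q\<close> reverses the
    order.\<close>
  define c1 where "c1 = (v 0 + b) powr (- q) / (p + 1)"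
  define c2 where "c2 = a powr (- q) / (p + 1)"
  \<comment> \<open>Both \<open>a\<close> and \<open>b\<close> bound the same increment, so
    \<open>a \<le> b\<close>, and \<open>v 0 > 0\<close> makes the inequality strict.\<close>
  have "a < v 0 + b" using growth[of 1] a v_pos[of 0] iterate_powr_increment[OF p x0, of 0]
    by (simp add: a_def b_def r_def B_def)
  then have c: "0 < c1" "c1 < c2"
    using a b q p v_pos[of 0] by (auto simp: c1_def c2_def intro!: divide_strict_right_mono powr_less_mono2_neg)
  have "c1 * real k powr (- q) \<le> v k powr (- q) / (p + 1) \<and>
        v k powr (- q) / (p + 1) \<le> c2 * real k powr (- q)" if "k \<ge> 1" for k
  proof
    have k: "real k \<ge> 1" using that by simp
    have "v 0 * 1 \<le> v 0 * real k" using k v_pos[of 0] by (intro mult_left_mono) auto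
    then have "v k \<le> (v 0 + b) * real k" using growth[of k] by (simp add: algebra_simps)
    then have "((v 0 + b) * real k) powr (- q) \<le> v k powr (- q)"
      using v_pos[of k] q by (intro powr_mono2') auto
    then show "c1 * real k powr (- q) \<le> v k powr (- q) / (p + 1)"
      using p b v_pos[of 0] by (simp add: c1_def powr_mult divide_right_mono)
    have "a * real k \<le> v k" using growth[of k] v_pos[of 0] by linarith
    then have "v k powr (- q) \<le> (a * real k) powr (- q)"
      using a k q by (intro powr_mono2') auto
    then show "v k powr (- q) / (p + 1) \<le> c2 * real k powr (- q)"
      using p a by (simp add: c2_def powr_mult divide_right_mono)
  qed
  then show ?thesis using c unfolding merit q_def[symmetric] by blast
qed

text \<open>By the lower bound, a faster rate for the merit would carry over to
  \<open>k powr (- rate_exp p)\<close> itself.\<close>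

lemma merit_iterate_not_bigo:
  assumes "p > 2" "0 < x0" "x0 < 1" "rate_exp p < e"
  shows "(\<lambda>k. merit (obj1 p) (obj2 p) (iterate p x0 k)) \<notin> O(\<lambda>k. real k powr (- e))"
proof
  assume bigo: "(\<lambda>k. merit (obj1 p) (obj2 p) (iterate p x0 k)) \<in> O(\<lambda>k. real k powr (- e))"
  obtain c1 where c1: "0 < c1" "\<And>k. k \<ge> 1 \<Longrightarrow>
      c1 * real k powr (- rate_exp p) \<le> merit (obj1 p) (obj2 p) (iterate p x0 k)"
    using merit_iterate_bounds[OF assms(1-3)] by blast
  have "(\<lambda>k. real k powr (- rate_exp p)) \<in> O(\<lambda>k. merit (obj1 p) (obj2 p) (iterate p x0 k))"
  proof (rule bigoI[where c = "1 / c1"], rule eventually_sequentiallyI[of 1])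
    fix k :: nat assume "k \<ge> 1"
    with c1 show "norm (real k powr (- rate_exp p))
        \<le> 1 / c1 * norm (merit (obj1 p) (obj2 p) (iterate p x0 k))"
      by (auto simp: field_simps intro: order.trans[OF _ abs_ge_self])
  qed
  from landau_o.big_trans[OF this bigo]
  have "(\<lambda>k. real k powr (- rate_exp p)) \<in> O(\<lambda>k. real k powr (- e))" .
  then have "- rate_exp p \<le> - e"
    using powr_bigo_iff[OF filterlim_real_sequentially] by simp
  with assms show False by simp
qed

text \<open>The nonvanishing stationarity measure shows that the stopping rule never fires, so the
  rate is not about a sequence frozen at a stationary point.\<close>

theorem corollary4p2:
  shows "(\<forall>p::real. \<forall>x0::real. p > 2 \<longrightarrow> 0 < x0 \<longrightarrow> x0 < 1 \<longrightarrow>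
            (\<forall>k. stationarity (obj1 p) (obj2 p) (iterate p x0 k) \<noteq> 0) \<and>
            rate_exp p = 2 + 6 / (p - 2) \<and>
            (\<exists>c1 c2 :: real. \<exists>K::nat. 0 < c1 \<and> c1 < c2 \<and> K \<ge> 1 \<and>
               (\<forall>k\<ge>K. c1 * real k powr (- rate_exp p) \<le> merit (obj1 p) (obj2 p) (iterate p x0 k) \<and>
                       merit (obj1 p) (obj2 p) (iterate p x0 k) \<le> c2 * real k powr (- rate_exp p))))
       \<and> (\<forall>\<delta>::real. \<delta> > 0 \<longrightarrow>
            (\<exists>p>2. \<forall>x0::real. 0 < x0 \<longrightarrow> x0 < 1 \<longrightarrow>
               (\<lambda>k. merit (obj1 p) (obj2 p) (iterate p x0 k)) \<notin> O(\<lambda>k. real k powr (- (2 + \<delta>)))))"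
proof (intro conjI allI impI)
  fix p x0 :: real and k :: nat
  assume p: "p > 2" and x0: "0 < x0" "x0 < 1"
  show "stationarity (obj1 p) (obj2 p) (iterate p x0 k) \<noteq> 0"
    using iterate_in_unit_interval[OF p x0, of k] p by (simp add: stationarity_obj)
next
  fix p :: real assume "p > 2"
  then show "rate_exp p = 2 + 6 / (p - 2)" by (simp add: rate_exp_def field_simps)
next
  fix p x0 :: real
  assume "p > 2" "0 < x0" "x0 < 1"
  from merit_iterate_bounds[OF this]
  show "\<exists>c1 c2 :: real. \<exists>K::nat. 0 < c1 \<and> c1 < c2 \<and> K \<ge> 1 \<and>
      (\<forall>k\<ge>K. c1 * real k powr (- rate_exp p) \<le> merit (obj1 p) (obj2 p) (iterate p x0 k) \<and>
              merit (obj1 p) (obj2 p) (iterate p x0 k) \<le> c2 * real k powr (- rate_exp p))"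
    by blast
next
  fix \<delta> :: real assume \<delta>: "\<delta> > 0"
  \<comment> \<open>This choice gives \<open>6 / (p - 2) = \<delta> / 2\<close>, hence
    \<open>rate_exp p = 2 + \<delta> / 2\<close>.\<close>
  define p where "p = 2 + 12 / \<delta>"
  have "p > 2" "rate_exp p < 2 + \<delta>"
    using \<delta> by (auto simp: p_def rate_exp_def field_simps)
  then show "\<exists>p>2. \<forall>x0::real. 0 < x0 \<longrightarrow> x0 < 1 \<longrightarrow>
      (\<lambda>k. merit (obj1 p) (obj2 p) (iterate p x0 k)) \<notin> O(\<lambda>k. real k powr (- (2 + \<delta>)))"
    using merit_iterate_not_bigo by blast
qed

end
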